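(* Let $\boldsymbol{x}_1,\ldots,\boldsymbol{x}_n$ be a random sample from $\boldsymbol{X}\sim N_d(\boldsymbol{\mu},\boldsymbol{\Sigma};\boldsymbol{0})$, where $\boldsymbol{\mu}\in\mathbb{R}^d$ and $\boldsymbol{\Sigma}$ is a positive definite symmetric $d\times d$ matrix, and suppose that $(\widehat{\boldsymbol{\mu}},\widehat{\boldsymbol{\Sigma}})$, the maximum likelihood estimator of $(\boldsymbol{\mu},\boldsymbol{\Sigma})$, exists and is in the interior of the parameter space. Then $(\widehat{\boldsymbol{\mu}},\widehat{\boldsymbol{\Sigma}})$ satisfies the equations $$\widehat{\boldsymbol{\mu}}+[C(\widehat{\boldsymbol{\mu}},\widehat{\boldsymbol{\Sigma}})]^{-1}\,\widehat{\boldsymbol{\Sigma}}\,(\nabla C)(\widehat{\boldsymbol{\mu}},\widehat{\boldsymbol{\Sigma}})=\overline{\boldsymbol{x}}$$ and $$\widehat{\boldsymbol{\Sigma}}+[C(\widehat{\boldsymbol{\mu}},\widehat{\boldsymbol{\Sigma}})]^{-1}\,\widehat{\boldsymbol{\Sigma}}\,(\nabla\nabla' C)(\widehat{\boldsymbol{\mu}},\widehat{\boldsymbol{\Sigma}})\,\widehat{\boldsymbol{\Sigma}}-(\overline{\boldsymbol{x}}-\widehat{\boldsymbol{\mu}})(\overline{\boldsymbol{x}}-\widehat{\boldsymbol{\mu}})'=\boldsymbol{S}(\overline{\boldsymbol{x}}).$$ Moreover, $\widehat{\boldsymbol{\nu}}=\overline{\boldsymbol{x}}$ and $\widehat{\boldsymbol{\Lambda}}=\boldsymbol{S}(\overline{\boldsymbol{x}})$,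 where $(\widehat{\boldsymbol{\nu}},\widehat{\boldsymbol{\Lambda}})$ is the maximum likelihood estimator of $(\boldsymbol{\nu},\boldsymbol{\Lambda})=(\mathbb{E}(\boldsymbol{X}),\mathrm{Cov}(\boldsymbol{X}))$.
   Context: Notation: $\mathbb{R}_+^d$ is the nonnegative orthant; a prime denotes transpose. $\boldsymbol{X}\sim N_d(\boldsymbol{\mu},\boldsymbol{\Sigma};\boldsymbol{0})$ means that $\boldsymbol{X}$ has the truncated normal density $$f(\boldsymbol{x};\boldsymbol{\mu},\boldsymbol{\Sigma})=[C(\boldsymbol{\mu},\boldsymbol{\Sigma})]^{-1}\exp\big[-\tfrac12(\boldsymbol{x}-\boldsymbol{\mu})'\boldsymbol{\Sigma}^{-1}(\boldsymbol{x}-\boldsymbol{\mu})\big],\quad\boldsymbol{x}\in\mathbb{R}_+^d,$$ with $$C(\boldsymbol{\mu},\boldsymbol{\Sigma})=\int_{\mathbb{R}_+^d}\exp\big[-\tfrac12(\boldsymbol{w}-\boldsymbol{\mu})'\boldsymbol{\Sigma}^{-1}(\boldsymbol{w}-\boldsymbol{\mu})\big]\,d\boldsymbol{w}.$$ $(\nabla C)(\boldsymbol{\mu},\boldsymbol{\Sigma})$ and $(\nabla\nabla'C)(\boldsymbol{\mu},\boldsymbol{\Sigma})$ denote the gradient (column vector) and Hessian matrix of $\boldsymbol{t}\mapsto C(\boldsymbol{t},\boldsymbol{\Sigma})$ evaluated at $\boldsymbol{t}=\boldsymbol{\mu}$. Also $\overline{\boldsymbol{x}}=n^{-1}\sum_{j=1}^n\boldsymbol{x}_j$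 and, for $\boldsymbol{\alpha}\in\mathbb{R}^d$, $\boldsymbol{S}(\boldsymbol{\alpha})=n^{-1}\sum_{j=1}^n(\boldsymbol{x}_j-\boldsymbol{\alpha})(\boldsymbol{x}_j-\boldsymbol{\alpha})'$. By the invariance principle, $\widehat{\boldsymbol{\nu}}$ and $\widehat{\boldsymbol{\Lambda}}$ are the mean and covariance matrix of $N_d(\widehat{\boldsymbol{\mu}},\widehat{\boldsymbol{\Sigma}};\boldsymbol{0})$, i.e. $\boldsymbol{\nu}$ and $\boldsymbol{\Lambda}$ regarded as functions of $(\boldsymbol{\mu},\boldsymbol{\Sigma})$ and evaluated at $(\widehat{\boldsymbol{\mu}},\widehat{\boldsymbol{\Sigma}})$. The log-likelihood is $\ell(\boldsymbol{\mu},\boldsymbol{\Sigma})=\sum_{j=1}^n\log f(\boldsymbol{x}_j;\boldsymbol{\mu},\boldsymbol{\Sigma})$; "in the interior of the parameter space" means that $\widehat{\boldsymbol{\mu}}\in\mathbb{R}^d$ and $\widehat{\boldsymbol{\Sigma}}$ is positive definite. *)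

theory Defs
  imports "HOL-Probability.Probability"
begin

definition pos_def :: "real^'d^'d \<Rightarrow> bool" where
  "pos_def A \<longleftrightarrow> transpose A = A \<and> (\<forall>v. v \<noteq> 0 \<longrightarrow> 0 < v \<bullet> (A *v v))"

definition outer :: "real^'d \<Rightarrow> real^'d \<Rightarrow> real^'d^'d" where
  "outer u v = (\<chi> i j. u $ i * v $ j)"

definition gradient :: "(real^'d \<Rightarrow> real) \<Rightarrow> real^'d \<Rightarrow> real^'d" where
  "gradient f x = (\<chi> i. frechet_derivative f (at x) (axis i 1))"

definition hessian :: "(real^'d \<Rightarrow> real) \<Rightarrow> real^'d \<Rightarrow> real^'d^'d" where
  "hessian f x = jacobian (gradient f) (at x)"

definition nonneg_orthant :: "(real^'d) set" where
  "nonneg_orthant = {x. \<forall>i. 0 \<le> x $ i}"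

definition gauss_kernel :: "real^'d \<Rightarrow> real^'d^'d \<Rightarrow> real^'d \<Rightarrow> real" where
  "gauss_kernel \<mu> V x = exp (- (1/2) * ((x - \<mu>) \<bullet> (matrix_inv V *v (x - \<mu>))))"

definition tn_const :: "real^'d \<Rightarrow> real^'d^'d \<Rightarrow> real" where
  "tn_const \<mu> V = (LINT w:nonneg_orthant|lborel. gauss_kernel \<mu> V w)"

text \<open>The density on the orthant is extended by zero to the whole space, so that it is a density
  with respect to \<^const>\<open>lborel\<close>.\<close>

definition tn_density :: "real^'d \<Rightarrow> real^'d^'d \<Rightarrow> real^'d \<Rightarrow> real" where
  "tn_density \<mu> V x =
     indicator nonneg_orthant x * (inverse (tn_const \<mu> V) * gauss_kernel \<mu> V x)"

definition tn_law :: "real^'d \<Rightarrow> real^'d^'d \<Rightarrow> (real^'d) measure" where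
  "tn_law \<mu> V = density lborel (\<lambda>x. ennreal (tn_density \<mu> V x))"

definition tn_mean :: "real^'d \<Rightarrow> real^'d^'d \<Rightarrow> real^'d" where
  "tn_mean \<mu> V = (LINT x|tn_law \<mu> V. x)"

definition tn_cov :: "real^'d \<Rightarrow> real^'d^'d \<Rightarrow> real^'d^'d" where
  "tn_cov \<mu> V = (LINT x|tn_law \<mu> V. outer (x - tn_mean \<mu> V) (x - tn_mean \<mu> V))"

definition sample_mean :: "nat \<Rightarrow> (nat \<Rightarrow> real^'d) \<Rightarrow> real^'d" where
  "sample_mean n x = (1 / real n) *\<^sub>R (\<Sum>j=1..n. x j)"

definition scatter :: "nat \<Rightarrow> (nat \<Rightarrow> real^'d) \<Rightarrow> real^'d \<Rightarrow> real^'d^'d" where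
  "scatter n x \<alpha> = (1 / real n) *\<^sub>R (\<Sum>j=1..n. outer (x j - \<alpha>) (x j - \<alpha>))"

text \<open>Meaningful only for observations in the orthant: elsewhere the density is zero, and
  \<^const>\<open>ln\<close> takes a default value there.\<close>

definition log_likelihood :: "nat \<Rightarrow> (nat \<Rightarrow> real^'d) \<Rightarrow> real^'d \<Rightarrow> real^'d^'d \<Rightarrow> real" where
  "log_likelihood n x \<mu> V = (\<Sum>j=1..n. ln (tn_density \<mu> V (x j)))"

definition is_mle :: "nat \<Rightarrow> (nat \<Rightarrow> real^'d) \<Rightarrow> real^'d \<Rightarrow> real^'d^'d \<Rightarrow> bool" where
  "is_mle n x \<mu> V \<longleftrightarrow>
     is_arg_max (\<lambda>(\<mu>, V). log_likelihood n x \<mu> V) (\<lambda>(\<mu>, V). pos_def V) (\<mu>, V)"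

end

theory Submission
  imports Defs
begin

text \<open>
  In the parameters \<open>\<theta> = \<Sigma>\<^sup>-\<^sup>1 \<mu>\<close> and \<open>P = \<Sigma>\<^sup>-\<^sup>1\<close> the truncated normal laws form an exponential family:
  up to normalisation the density on the orthant is \<open>exp (\<theta> \<bullet> w - w \<bullet> P w / 2)\<close>, so its sufficient
  statistics are the polynomials in \<open>w\<close> of degree at most two.  As in every exponential family,
  an interior maximum of the likelihood makes the expectation of each sufficient statistic equal to
  its sample average.

  This is shown along curves, without differentiating with respect to a matrix.  Let \<open>T\<close>
  be a quadratic polynomial with sample average \<open>m\<close>.  For small \<open>s\<close> the kernel of the estimated law,
  multiplied by \<open>exp (s * T w)\<close>, is a constant times the kernel of another member of the family
  (\<open>gauss_kernel_tilt\<close>), because positive definiteness of \<open>P\<close> survives small symmetric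
  perturbations.  Comparing the two likelihoods says that the integral of the estimated
  kernel times \<open>exp (s * (T w - m))\<close> has a local minimum at \<open>s = 0\<close>; its derivative there is the
  integral of the kernel times \<open>T w - m\<close>, which must therefore vanish (\<open>mle_matches_quadratic\<close>).
  Coordinates and products of coordinates are instances of \<open>T\<close>, hence the mean and all second
  moments of the estimated law agree with those of the sample (\<open>mle_matches_moments\<close>).

  The two equations in \<open>C\<close> restate this.  Writing \<open>A\<close> for the integral of the kernel times
  \<open>(w - \<mu>) (w - \<mu>)'\<close>, differentiation under the integral sign gives
  \<open>\<Sigma> \<nabla>C = C (\<nu> - \<mu>)\<close> (\<open>gradient_tn_const\<close>) and \<open>\<Sigma> (\<nabla>\<nabla>'C) \<Sigma> = A - C \<Sigma>\<close>
  (\<open>hessian_tn_const\<close>), and \<open>A / C\<close> is the second moment about \<open>\<mu>\<close>, that is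
  \<open>\<Lambda> + (\<nu> - \<mu>) (\<nu> - \<mu>)'\<close>.

  All differentiations are instances of one lemma on integrals of \<open>exp (s \<bullet> S w)\<close>
  (\<open>has_derivative_exp_integral\<close>), applied with \<open>S w = w - \<mu>\<close> for the derivatives of \<open>C\<close> and
  with \<open>S w = T w - m\<close> for the likelihood comparison.
\<close>

section \<open>Positive definite matrices\<close>

lemma matrix_inv_eqI:
  fixes A B :: "real^'d^'d"
  assumes "A ** B = mat 1"
  shows "matrix_inv A = B"
proof -
  have BA: "B ** A = mat 1"
    using assms matrix_left_right_inverse by blast
  have "A ** matrix_inv A = mat 1 \<and> matrix_inv A ** A = mat 1"
    unfolding matrix_inv_def by (rule someI[of _ B]) (use assms BA in auto)
  then show ?thesis
    by (metis BA matrix_mul_assoc matrix_mul_lid matrix_mul_rid)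
qed

lemma pos_def_matrix_inv:
  fixes A :: "real^'d^'d"
  assumes "pos_def A"
  shows "A ** matrix_inv A = mat 1" "matrix_inv A ** A = mat 1"
proof -
  have "invertible A"
    unfolding invertible_left_inverse matrix_left_invertible_ker
    using assms unfolding pos_def_def by (metis inner_zero_right less_irrefl)
  then obtain B where B: "A ** B = mat 1" "B ** A = mat 1"
    unfolding invertible_def by blast
  then show "A ** matrix_inv A = mat 1" "matrix_inv A ** A = mat 1"
    using matrix_inv_eqI[OF B(1)] by auto
qed

lemma symmetric_matrix_inner_commute:
  fixes A :: "real^'d^'d"
  assumes "transpose A = A"
  shows "u \<bullet> (A *v v) = (A *v u) \<bullet> v"
  by (metis assms dot_lmul_matrix transpose_matrix_vector)

lemma pos_def_inverse:
  fixes A :: "real^'d^'d"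
  assumes "pos_def A"
  shows "pos_def (matrix_inv A)"
proof -
  note inv = pos_def_matrix_inv[OF assms]
  have sym: "transpose A = A"
    using assms by (simp add: pos_def_def)
  have "A ** transpose (matrix_inv A) = mat 1"
    by (metis inv(2) matrix_transpose_mul sym transpose_mat)
  then have "transpose (matrix_inv A) = matrix_inv A"
    by (metis matrix_inv_eqI)
  moreover have "0 < v \<bullet> (matrix_inv A *v v)" if "v \<noteq> 0" for v
  proof -
    define u where "u = matrix_inv A *v v"
    have v: "v = A *v u"
      by (simp add: u_def inv(1) matrix_vector_mul_assoc)
    then have "u \<noteq> 0"
      using that by auto
    then have "0 < u \<bullet> (A *v u)"
      using assms by (simp add: pos_def_def)
    then show ?thesis
      unfolding u_def[symmetric] by (simp add: v inner_commute)
  qed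
  ultimately show ?thesis
    by (simp add: pos_def_def)
qed

lemma matrix_inv_matrix_inv:
  fixes A :: "real^'d^'d"
  assumes "pos_def A"
  shows "matrix_inv (matrix_inv A) = A"
  by (rule matrix_inv_eqI) (rule pos_def_matrix_inv(2)[OF assms])

text \<open>
  The quadratic form attains a minimum on the unit sphere, which is positive, and it is homogeneous
  of degree two.
\<close>

lemma pos_def_coercive:
  fixes A :: "real^'d^'d"
  assumes "pos_def A"
  obtains a where "0 < a" "\<And>v. a * (norm v)\<^sup>2 \<le> v \<bullet> (A *v v)"
proof -
  have "continuous_on (sphere 0 1) (\<lambda>v. v \<bullet> (A *v v))"
    by (intro continuous_on_inner continuous_on_id linear_continuous_on matrix_vector_mul_bounded_linear)
  then have "\<exists>u\<in>sphere 0 1. \<forall>v\<in>sphere 0 1. u \<bullet> (A *v u) \<le> v \<bullet> (A *v v)"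
    by (intro continuous_attains_inf) auto
  then obtain u where u: "norm u = 1" "\<And>v. norm v = 1 \<Longrightarrow> u \<bullet> (A *v u) \<le> v \<bullet> (A *v v)"
    by auto
  show thesis
  proof
    show "0 < u \<bullet> (A *v u)"
      using assms u(1) unfolding pos_def_def by (metis norm_zero zero_neq_one)
    show "u \<bullet> (A *v u) * (norm v)\<^sup>2 \<le> v \<bullet> (A *v v)" for v
    proof (cases "v = 0")
      case False
      define z where "z = (1 / norm v) *\<^sub>R v"
      have v: "v = norm v *\<^sub>R z"
        using False by (simp add: z_def)
      have "v \<bullet> (A *v v) = (norm v)\<^sup>2 * (z \<bullet> (A *v z))"
        by (subst (1 2) v) (simp add: matrix_vector_mult_scaleR power2_eq_square)
      moreover have "u \<bullet> (A *v u) \<le> z \<bullet> (A *v z)"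
        by (rule u) (use False in \<open>simp add: z_def\<close>)
      ultimately show ?thesis
        by (metis mult.commute mult_left_mono zero_le_power2)
    qed simp
  qed
qed

lemma quadratic_form_bound:
  fixes H :: "real^'d^'d"
  obtains K where "0 < K" "\<And>v. \<bar>v \<bullet> (H *v v)\<bar> \<le> K * (norm v)\<^sup>2"
proof -
  obtain K where K: "0 < K" "\<And>v. norm (H *v v) \<le> norm v * K"
    using bounded_linear.pos_bounded[OF matrix_vector_mul_bounded_linear[of H]] by blast
  show thesis
  proof
    show "\<bar>v \<bullet> (H *v v)\<bar> \<le> K * (norm v)\<^sup>2" for v
    proof -
      have "\<bar>v \<bullet> (H *v v)\<bar> \<le> norm v * norm (H *v v)"
        by (rule Cauchy_Schwarz_ineq2)
      also have "\<dots> \<le> norm v * (norm v * K)"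
        by (intro mult_left_mono K) auto
      finally show ?thesis by (simp add: power2_eq_square mult_ac)
    qed
  qed (rule K)
qed

section \<open>Gaussian integrability and differentiation under the integral\<close>

text \<open>
  The integrand is a product of one-dimensional Gaussians over an orthonormal basis, and Lebesgue
  measure is the corresponding product measure.
\<close>

lemma integrable_exp_neg_norm_square:
  fixes a :: real
  assumes "0 < a"
  shows "integrable lborel (\<lambda>x :: 'e::euclidean_space. exp (- a * (norm x)\<^sup>2))"
proof -
  interpret P: product_sigma_finite "\<lambda>_::'e. lborel :: real measure"
    by standard
  have "integrable lborel (normal_density 0 (1 / sqrt (2 * a)))"
    using assms by (intro integrable_normal_density) simp
  then have "integrable lborel (\<lambda>t. sqrt (pi / a) * normal_density 0 (1 / sqrt (2 * a)) t)"
    by (rule integrable_mult_right)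
  then have one: "integrable lborel (\<lambda>t::real. exp (- a * t\<^sup>2))"
    by (rule Bochner_Integration.integrable_cong[THEN iffD1, rotated 2])
       (use assms in \<open>auto simp: normal_density_def field_simps real_sqrt_divide real_sqrt_mult\<close>)
  have "integrable (\<Pi>\<^sub>M b\<in>(Basis :: 'e set). lborel) (\<lambda>f. \<Prod>b\<in>Basis. exp (- a * (f b)\<^sup>2))"
    by (intro P.product_integrable_prod one) auto
  moreover have "(\<Prod>b\<in>Basis. exp (- a * (f b)\<^sup>2)) =
      exp (- a * (norm (\<Sum>b\<in>Basis. f b *\<^sub>R b :: 'e))\<^sup>2)" for f
  proof -
    have "(norm (\<Sum>b\<in>Basis. f b *\<^sub>R b :: 'e))\<^sup>2 = (\<Sum>b\<in>Basis. (f b)\<^sup>2)"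
      unfolding power2_norm_eq_inner
      by (subst euclidean_inner) (simp add: power2_eq_square)
    then show ?thesis
      by (simp add: exp_sum[symmetric] sum_distrib_left sum_negf)
  qed
  ultimately have "integrable (\<Pi>\<^sub>M b\<in>(Basis :: 'e set). lborel)
      (\<lambda>f. exp (- a * (norm (\<Sum>b\<in>Basis. f b *\<^sub>R b :: 'e))\<^sup>2))"
    by simp
  then show ?thesis
    by (subst lborel_eq, subst integrable_distr_eq) auto
qed

lemma square_le_exp:
  fixes u :: real
  assumes "0 \<le> u"
  shows "u\<^sup>2 \<le> 2 * exp u"
  using exp_lower_Taylor_quadratic[OF assms] assms by (simp add: power2_eq_square)

lemma exp_remainder_bound:
  fixes u :: real
  shows "\<bar>exp u - 1 - u\<bar> \<le> u\<^sup>2 * exp \<bar>u\<bar>"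
proof -
  have "\<exists>t. \<bar>t\<bar> \<le> \<bar>u\<bar> \<and> exp u = (\<Sum>m<2. u ^ m / fact m) + exp t / fact 2 * u ^ 2"
    by (rule Maclaurin_exp_le)
  then obtain t where t: "\<bar>t\<bar> \<le> \<bar>u\<bar>" "exp u = 1 + u + exp t / 2 * u\<^sup>2"
    by (auto simp: numeral_2_eq_2)
  have "\<bar>exp u - 1 - u\<bar> = exp t / 2 * u\<^sup>2"
    by (simp add: t(2))
  also have "\<dots> \<le> exp \<bar>u\<bar> * u\<^sup>2"
  proof (rule mult_right_mono)
    have "exp t / 2 \<le> exp t" by simp
    also have "exp t \<le> exp \<bar>u\<bar>" using t(1) by simp
    finally show "exp t / 2 \<le> exp \<bar>u\<bar>" .
  qed simp
  finally show ?thesis by (simp add: mult.commute)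
qed

text \<open>
  Laplace transforms are differentiable wherever they stay finite with some room: the remainder
  \<open>exp u - 1 - u\<close> at \<open>u = h \<bullet> S w\<close> is of order \<open>\<bar>h\<bar>\<^sup>2 \<bar>S w\<bar>\<^sup>2 exp (\<bar>h\<bar> \<bar>S w\<bar>)\<close>, and for
  \<open>\<bar>h\<bar> \<le> e / 2\<close> both \<open>\<bar>S w\<bar>\<^sup>2\<close> and the exponential are absorbed by \<open>exp (e * norm (S w))\<close>, half of
  the exponent being spent on each.  It suffices to differentiate at \<open>0\<close>, since another base
  point can be moved into the weight \<open>f\<close>.
\<close>

lemma has_derivative_exp_integral:
  fixes S :: "'a \<Rightarrow> 'e::euclidean_space" and f :: "'a \<Rightarrow> real"
  assumes [measurable]: "S \<in> borel_measurable N" "f \<in> borel_measurable N"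
    and e: "0 < e"
    and int: "integrable N (\<lambda>w. f w * exp (e * norm (S w)))"
  shows "((\<lambda>s. \<integral>w. f w * exp (s \<bullet> S w) \<partial>N) has_derivative
          (\<lambda>h. \<integral>w. f w * (h \<bullet> S w) \<partial>N)) (at 0)"
proof -
  have dom: "integrable N g" if [measurable]: "g \<in> borel_measurable N"
    and le: "\<And>w. \<bar>g w\<bar> \<le> c * (\<bar>f w\<bar> * exp (e * norm (S w)))" for g c
  proof (rule Bochner_Integration.integrable_bound[OF integrable_mult_right[OF integrable_abs[OF int], of c]])
    show "AE w in N. norm (g w) \<le> norm (c * \<bar>f w * exp (e * norm (S w))\<bar>)"
    proof (rule AE_I2)
      fix w
      show "norm (g w) \<le> norm (c * \<bar>f w * exp (e * norm (S w))\<bar>)"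
        using le[of w] abs_ge_self[of "c * (\<bar>f w\<bar> * exp (e * norm (S w)))"] by (simp add: abs_mult)
    qed
  qed measurable
  have lin: "integrable N (\<lambda>w. f w * (h \<bullet> S w))" for h
  proof (rule dom[where c = "norm h / e"])
    fix w
    have "\<bar>h \<bullet> S w\<bar> \<le> norm h * norm (S w)"
      by (rule Cauchy_Schwarz_ineq2)
    also have "\<dots> = norm h / e * (e * norm (S w))"
      using e by simp
    also have "\<dots> \<le> norm h / e * exp (e * norm (S w))"
      using e exp_ge_add_one_self[of "e * norm (S w)"]
      by (intro mult_left_mono) (linarith, simp)
    finally have "\<bar>f w\<bar> * \<bar>h \<bullet> S w\<bar> \<le> \<bar>f w\<bar> * (norm h / e * exp (e * norm (S w)))"
      by (intro mult_left_mono) auto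
    then show "\<bar>f w * (h \<bullet> S w)\<bar> \<le> norm h / e * (\<bar>f w\<bar> * exp (e * norm (S w)))"
      by (simp add: abs_mult mult_ac)
  qed measurable
  have ex: "integrable N (\<lambda>w. f w * exp (s \<bullet> S w))" if "norm s \<le> e" for s
  proof (rule dom[where c = 1])
    fix w
    have "s \<bullet> S w \<le> e * norm (S w)"
      by (rule order_trans[OF norm_cauchy_schwarz mult_right_mono[OF that]]) simp
    then show "\<bar>f w * exp (s \<bullet> S w)\<bar> \<le> 1 * (\<bar>f w\<bar> * exp (e * norm (S w)))"
      by (simp add: abs_mult mult_left_mono)
  qed measurable
  \<comment> \<open>The factor is \<open>2 * (2 / e)\<^sup>2\<close>, from \<open>u\<^sup>2 \<le> 2 * exp u\<close> at \<open>u = e / 2 * norm (S w)\<close>.\<close>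
  define M where "M = 8 / e\<^sup>2 * (\<integral>w. \<bar>f w\<bar> * exp (e * norm (S w)) \<partial>N)"
  have rem: "\<bar>(\<integral>w. f w * exp (h \<bullet> S w) \<partial>N) - (\<integral>w. f w * exp (0 \<bullet> S w) \<partial>N) - (\<integral>w. f w * (h \<bullet> S w) \<partial>N)\<bar>
      \<le> M * (norm h)\<^sup>2" if h: "norm h \<le> e / 2" for h
  proof -
    let ?r = "\<lambda>w. f w * exp (h \<bullet> S w) - f w * exp (0 \<bullet> S w) - f w * (h \<bullet> S w)"
    have r: "\<bar>?r w\<bar> \<le> 8 / e\<^sup>2 * (norm h)\<^sup>2 * (\<bar>f w\<bar> * exp (e * norm (S w)))" for w
    proof -
      let ?n = "norm (S w)" and ?u = "h \<bullet> S w"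
      have u: "\<bar>?u\<bar> \<le> norm h * ?n"
        by (rule Cauchy_Schwarz_ineq2)
      then have u2: "?u\<^sup>2 \<le> (norm h * ?n)\<^sup>2"
        by (metis abs_ge_zero power2_abs power_mono)
      have eu: "exp \<bar>?u\<bar> \<le> exp (e / 2 * ?n)"
        using order_trans[OF u mult_right_mono[OF h, of ?n]] by simp
      have "(norm h * ?n)\<^sup>2 = (2 / e * norm h)\<^sup>2 * (e / 2 * ?n)\<^sup>2"
        using e by (simp add: power2_eq_square)
      also have "\<dots> \<le> (2 / e * norm h)\<^sup>2 * (2 * exp (e / 2 * ?n))"
        using e by (intro mult_left_mono square_le_exp) auto
      also have "\<dots> = 8 / e\<^sup>2 * (norm h)\<^sup>2 * exp (e / 2 * ?n)"
        by (simp add: power2_eq_square)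
      finally have n2: "(norm h * ?n)\<^sup>2 \<le> 8 / e\<^sup>2 * (norm h)\<^sup>2 * exp (e / 2 * ?n)" .
      have "\<bar>exp ?u - 1 - ?u\<bar> \<le> ?u\<^sup>2 * exp \<bar>?u\<bar>"
        by (rule exp_remainder_bound)
      also have "\<dots> \<le> (8 / e\<^sup>2 * (norm h)\<^sup>2 * exp (e / 2 * ?n)) * exp (e / 2 * ?n)"
        by (intro mult_mono order_trans[OF u2 n2] eu) auto
      also have "\<dots> = 8 / e\<^sup>2 * (norm h)\<^sup>2 * exp (e * ?n)"
        by (simp add: mult_exp_exp)
      finally have "\<bar>f w\<bar> * \<bar>exp ?u - 1 - ?u\<bar> \<le> \<bar>f w\<bar> * (8 / e\<^sup>2 * (norm h)\<^sup>2 * exp (e * ?n))"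
        by (intro mult_left_mono) auto
      moreover have "?r w = f w * (exp ?u - 1 - ?u)"
        by (simp add: algebra_simps)
      ultimately show ?thesis
        by (simp add: abs_mult mult_ac)
    qed
    have h': "norm h \<le> e" using h e by linarith
    have intr: "integrable N ?r"
      using ex[OF h'] ex[of 0] e lin by (intro Bochner_Integration.integrable_diff) auto
    have "\<bar>\<integral>w. ?r w \<partial>N\<bar> \<le> (\<integral>w. \<bar>?r w\<bar> \<partial>N)"
      by (rule integral_abs_bound)
    also have "\<dots> \<le> (\<integral>w. 8 / e\<^sup>2 * (norm h)\<^sup>2 * (\<bar>f w\<bar> * exp (e * norm (S w))) \<partial>N)"
      using integrable_mult_right[OF integrable_abs[OF int], of "8 / e\<^sup>2 * (norm h)\<^sup>2"]
      by (intro integral_mono integrable_abs intr r) (simp_all add: abs_mult)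
    also have "\<dots> = M * (norm h)\<^sup>2"
      by (simp add: M_def)
    finally show ?thesis
      using ex[OF h'] ex[of 0] e lin[of h] by simp
  qed
  show ?thesis
  proof (rule has_derivativeI_sandwich[where e = "e / 2" and H = "\<lambda>y. M * norm y"])
    have "linear (\<lambda>h. \<integral>w. f w * (h \<bullet> S w) \<partial>N)"
      using lin by (intro linearI) (simp_all add: inner_add_left distrib_left mult.left_commute)
    then show "bounded_linear (\<lambda>h. \<integral>w. f w * (h \<bullet> S w) \<partial>N)"
      by (simp add: linear_conv_bounded_linear)
    show "((\<lambda>y. M * norm y) \<longlongrightarrow> 0) (at 0)"
      by (auto intro!: tendsto_eq_intros)
    show "norm ((\<integral>w. f w * exp (y \<bullet> S w) \<partial>N) - (\<integral>w. f w * exp (0 \<bullet> S w) \<partial>N) -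
        (\<integral>w. f w * ((y - 0) \<bullet> S w) \<partial>N)) / norm (y - 0) \<le> M * norm y"
      if "y \<noteq> 0" "dist y 0 < e / 2" for y
      using rem[of y] that by (simp add: divide_le_eq power2_eq_square mult_ac)
  qed (use e in simp)
qed

section \<open>The truncated normal kernel\<close>

definition tn_kernel :: "real^'d \<Rightarrow> real^'d^'d \<Rightarrow> real^'d \<Rightarrow> real" where
  "tn_kernel \<mu> V w = indicator nonneg_orthant w * gauss_kernel \<mu> V w"

lemma nonneg_orthant_borel [measurable]: "nonneg_orthant \<in> sets (borel :: (real^'d) measure)"
proof -
  have "closed (nonneg_orthant :: (real^'d) set)"
    unfolding nonneg_orthant_def by (intro closed_Collect_all closed_Collect_le continuous_intros)
  then show ?thesis by simp
qed

lemma gauss_kernel_borel [measurable]: "gauss_kernel \<mu> V \<in> borel_measurable borel"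
  unfolding gauss_kernel_def
  by (intro borel_measurable_continuous_onI continuous_intros linear_continuous_on_compose[OF _ matrix_vector_mul_linear])

lemma tn_kernel_borel [measurable]: "tn_kernel \<mu> V \<in> borel_measurable borel"
  unfolding tn_kernel_def[abs_def] by measurable

lemma tn_kernel_nonneg: "0 \<le> tn_kernel \<mu> V w"
  by (simp add: tn_kernel_def gauss_kernel_def)

lemma tn_const_eq: "tn_const \<mu> V = (\<integral>w. tn_kernel \<mu> V w \<partial>lborel)"
  by (simp add: tn_const_def set_lebesgue_integral_def tn_kernel_def)

text \<open>
  The kernel is at most \<open>exp (- (a / 2) * (norm (w - \<mu>))\<^sup>2)\<close> for a coercivity constant \<open>a\<close> of the inverse
  covariance, and Gaussian growth at half that rate leaves an integrable Gaussian.  Room for such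
  growth is what gives quadratic statistics exponential moments in the likelihood comparison.
\<close>

lemma integrable_tn_kernel_subgaussian:
  fixes V :: "real^'d^'d"
  assumes "pos_def V"
  obtains e where "0 < e"
    "\<And>(g :: real^'d \<Rightarrow> 'b::{banach,second_countable_topology}) K.
      \<lbrakk>g \<in> borel_measurable borel; \<And>w. norm (g w) \<le> K * exp (e * (norm (w - \<mu>))\<^sup>2)\<rbrakk>
      \<Longrightarrow> integrable lborel (\<lambda>w. tn_kernel \<mu> V w *\<^sub>R g w)"
proof -
  obtain a where a: "0 < a" "\<And>v. a * (norm v)\<^sup>2 \<le> v \<bullet> (matrix_inv V *v v)"
    using pos_def_coercive[OF pos_def_inverse[OF assms]] by blast
  show thesis
  proof (rule that[of "a / 4"])
    fix g :: "real^'d \<Rightarrow> 'b" and K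
    assume [measurable]: "g \<in> borel_measurable borel"
      and le: "\<And>w. norm (g w) \<le> K * exp (a / 4 * (norm (w - \<mu>))\<^sup>2)"
    have "integrable lborel (\<lambda>w::real^'d. exp (- (a / 4) * (norm w)\<^sup>2))"
      by (rule integrable_exp_neg_norm_square) (use a in simp)
    then have "integrable (distr lborel borel ((+) (- \<mu>))) (\<lambda>w::real^'d. exp (- (a / 4) * (norm w)\<^sup>2))"
      by (simp only: lborel_distr_plus)
    then have "integrable lborel (\<lambda>w. exp (- (a / 4) * (norm (w - \<mu>))\<^sup>2))"
      by (subst (asm) integrable_distr_eq) (auto simp: algebra_simps)
    then have "integrable lborel (\<lambda>w. K * exp (- (a / 4) * (norm (w - \<mu>))\<^sup>2))"
      by (rule integrable_mult_right)
    then show "integrable lborel (\<lambda>w. tn_kernel \<mu> V w *\<^sub>R g w)"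
    proof (rule Bochner_Integration.integrable_bound)
      show "AE w in lborel. norm (tn_kernel \<mu> V w *\<^sub>R g w)
          \<le> norm (K * exp (- (a / 4) * (norm (w - \<mu>))\<^sup>2))"
      proof (rule AE_I2)
        fix w
        have "tn_kernel \<mu> V w \<le> gauss_kernel \<mu> V w"
          by (simp add: tn_kernel_def gauss_kernel_def indicator_def)
        also have "\<dots> \<le> exp (- (a / 2) * (norm (w - \<mu>))\<^sup>2)"
          using a(2)[of "w - \<mu>"] by (simp add: gauss_kernel_def)
        finally have "norm (tn_kernel \<mu> V w *\<^sub>R g w)
            \<le> exp (- (a / 2) * (norm (w - \<mu>))\<^sup>2) * (K * exp (a / 4 * (norm (w - \<mu>))\<^sup>2))"
          by (simp only: norm_scaleR) (intro mult_mono le, auto simp: tn_kernel_nonneg)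
        also have "\<dots> = K * exp (- (a / 4) * (norm (w - \<mu>))\<^sup>2)"
          by (simp add: mult_exp_exp)
        also have "\<dots> \<le> norm \<dots>" by simp
        finally show "norm (tn_kernel \<mu> V w *\<^sub>R g w)
          \<le> norm (K * exp (- (a / 4) * (norm (w - \<mu>))\<^sup>2))" .
      qed
    qed measurable
  qed (use a in simp)
qed

lemma integrable_tn_kernel_subexp:
  fixes V :: "real^'d^'d" and g :: "real^'d \<Rightarrow> 'b::{banach,second_countable_topology}"
  assumes "pos_def V" and [measurable]: "g \<in> borel_measurable borel"
    and le: "\<And>w. norm (g w) \<le> K * exp (a * norm (w - \<mu>))"
  shows "integrable lborel (\<lambda>w. tn_kernel \<mu> V w *\<^sub>R g w)"
proof -
  obtain e where e: "0 < e"
    "\<And>(g :: real^'d \<Rightarrow> 'b) K.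
      \<lbrakk>g \<in> borel_measurable borel; \<And>w. norm (g w) \<le> K * exp (e * (norm (w - \<mu>))\<^sup>2)\<rbrakk>
      \<Longrightarrow> integrable lborel (\<lambda>w. tn_kernel \<mu> V w *\<^sub>R g w)"
    using integrable_tn_kernel_subgaussian[OF assms(1)] by blast
  have "0 \<le> K * exp (a * norm (0 - \<mu>))"
    using le[of 0] norm_ge_zero order_trans by blast
  then have K: "0 \<le> K" by (simp add: zero_le_mult_iff)
  show ?thesis
  proof (rule e(2))
    show "norm (g w) \<le> (K * exp (a\<^sup>2 / (4 * e))) * exp (e * (norm (w - \<mu>))\<^sup>2)" for w
    proof -
      let ?r = "norm (w - \<mu>)"
      \<comment> \<open>Completing the square: \<open>a * r \<le> e * r\<^sup>2 + a\<^sup>2 / (4 * e)\<close>.\<close>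
      have "0 \<le> (2 * e * ?r - a)\<^sup>2 / (4 * e)"
        using e(1) by simp
      also have "\<dots> = a\<^sup>2 / (4 * e) + e * ?r\<^sup>2 - a * ?r"
        using e(1) by (simp add: power2_eq_square field_simps)
      finally have "exp (a * ?r) \<le> exp (a\<^sup>2 / (4 * e) + e * ?r\<^sup>2)"
        by simp
      then have "K * exp (a * ?r) \<le> K * exp (a\<^sup>2 / (4 * e) + e * ?r\<^sup>2)"
        using K by (rule mult_left_mono)
      then show ?thesis
        using le[of w] by (simp add: exp_add mult.assoc)
    qed
  qed measurable
qed

lemma integrable_tn_kernel:
  assumes "pos_def V"
  shows "integrable lborel (tn_kernel \<mu> V)"
  using integrable_tn_kernel_subexp[OF assms, of "\<lambda>_. 1::real" 1 0 \<mu>] by simp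

text \<open>
  The kernel is positive on the unit cube, which has positive volume.
\<close>

lemma tn_const_pos:
  fixes V :: "real^'d^'d"
  assumes "pos_def V"
  shows "0 < tn_const \<mu> V"
proof -
  have "0 \<le> tn_const \<mu> V"
    unfolding tn_const_eq by (intro Bochner_Integration.integral_nonneg tn_kernel_nonneg)
  moreover have "tn_const \<mu> V \<noteq> 0"
  proof
    assume "tn_const \<mu> V = 0"
    then have "AE w in lborel. tn_kernel \<mu> V w = 0"
      unfolding tn_const_eq
      by (subst (asm) integral_nonneg_eq_0_iff_AE) (auto simp: integrable_tn_kernel[OF assms] tn_kernel_nonneg)
    then have "AE w in lborel. w \<notin> cbox 0 (One :: real^'d)"
    proof (rule AE_mp, intro AE_I2 impI notI)
      fix w :: "real^'d"
      assume "tn_kernel \<mu> V w = 0" and w: "w \<in> cbox 0 One"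
      have "w \<in> nonneg_orthant"
        using w by (auto simp: nonneg_orthant_def mem_box cart_eq_inner_axis Basis_vec_def)
      then show False
        using \<open>tn_kernel \<mu> V w = 0\<close> by (simp add: tn_kernel_def gauss_kernel_def)
    qed
    then have "emeasure lborel (cbox 0 (One :: real^'d)) = 0"
      by (subst (asm) AE_iff_measurable[OF _ refl]) auto
    moreover have "emeasure lborel (cbox 0 (One :: real^'d)) = 1"
      by (subst emeasure_lborel_cbox) auto
    ultimately show False by simp
  qed
  ultimately show ?thesis by simp
qed

text \<open>
  Moving the centre of the kernel amounts to an exponential tilt, linear in \<open>w\<close>, and a factor that
  depends on the centre only; this turns derivatives in the centre into derivatives of a Laplace
  transform.
\<close>

lemma gauss_kernel_shift:
  fixes V :: "real^'d^'d"
  assumes "pos_def V"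
  shows "gauss_kernel t V w = exp (- (1/2) * ((t - \<mu>) \<bullet> (matrix_inv V *v (t - \<mu>)))) *
    (gauss_kernel \<mu> V w * exp ((matrix_inv V *v (t - \<mu>)) \<bullet> (w - \<mu>)))"
proof -
  let ?P = "matrix_inv V"
  define d where "d = t - \<mu>"
  define v where "v = w - \<mu>"
  have "transpose ?P = ?P"
    using pos_def_inverse[OF assms] by (simp add: pos_def_def)
  then have c: "v \<bullet> (?P *v d) = d \<bullet> (?P *v v)" "(?P *v d) \<bullet> v = d \<bullet> (?P *v v)"
    by (metis symmetric_matrix_inner_commute inner_commute)+
  have w: "w - t = v - d" by (simp add: v_def d_def)
  show ?thesis
    unfolding gauss_kernel_def w d_def[symmetric] v_def[symmetric]
    by (simp add: mult_exp_exp c matrix_vector_mult_diff_distrib inner_diff_left inner_diff_right field_simps)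
qed

text \<open>
  The factor depending on the centre only has value \<open>1\<close> and derivative \<open>0\<close> at \<open>t = \<mu>\<close>, so only the
  exponential tilt contributes.
\<close>

lemma tn_kernel_integral_has_derivative:
  fixes V :: "real^'d^'d" and g :: "real^'d \<Rightarrow> real"
  assumes V: "pos_def V" and [measurable]: "g \<in> borel_measurable borel"
    and le: "\<And>w. \<bar>g w\<bar> \<le> K * exp (norm (w - \<mu>))"
  shows "((\<lambda>t. \<integral>w. tn_kernel t V w * g w \<partial>lborel) has_derivative
          (\<lambda>h. \<integral>w. tn_kernel \<mu> V w * g w * ((matrix_inv V *v h) \<bullet> (w - \<mu>)) \<partial>lborel)) (at \<mu>)"
proof -
  let ?P = "matrix_inv V"
  define F where "F s = (\<integral>w. tn_kernel \<mu> V w * g w * exp (s \<bullet> (w - \<mu>)) \<partial>lborel)" for s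
  define q where "q t = exp (- (1/2) * ((t - \<mu>) \<bullet> (?P *v (t - \<mu>))))" for t
  have "integrable lborel (\<lambda>w. tn_kernel \<mu> V w *\<^sub>R (g w * exp (norm (w - \<mu>))))"
  proof (rule integrable_tn_kernel_subexp[OF V])
    show "norm (g w * exp (norm (w - \<mu>))) \<le> K * exp (2 * norm (w - \<mu>))" for w
      using mult_right_mono[OF le, of "exp (norm (w - \<mu>))" w]
      by (simp add: abs_mult mult_exp_exp mult.assoc)
  qed measurable
  then have "(F has_derivative (\<lambda>h. \<integral>w. tn_kernel \<mu> V w * g w * (h \<bullet> (w - \<mu>)) \<partial>lborel)) (at 0)"
    unfolding F_def by (intro has_derivative_exp_integral[where e = 1]) (auto simp: mult.assoc)
  moreover have "((\<lambda>t. ?P *v (t - \<mu>)) has_derivative (\<lambda>h. ?P *v h)) (at \<mu>)"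
    by (auto intro!: derivative_eq_intros bounded_linear.has_derivative[OF matrix_vector_mul_bounded_linear])
  ultimately have FP: "((\<lambda>t. F (?P *v (t - \<mu>))) has_derivative
      (\<lambda>h. \<integral>w. tn_kernel \<mu> V w * g w * ((?P *v h) \<bullet> (w - \<mu>)) \<partial>lborel)) (at \<mu>)"
    using has_derivative_compose[of "\<lambda>t. ?P *v (t - \<mu>)" "\<lambda>h. ?P *v h" \<mu> UNIV F] by simp
  have "(q has_derivative (\<lambda>h. 0)) (at \<mu>)"
    unfolding q_def
    by (auto intro!: derivative_eq_intros bounded_linear.has_derivative[OF matrix_vector_mul_bounded_linear])
  from has_derivative_mult[OF this FP]
  have "((\<lambda>t. q t * F (?P *v (t - \<mu>))) has_derivative
      (\<lambda>h. \<integral>w. tn_kernel \<mu> V w * g w * ((?P *v h) \<bullet> (w - \<mu>)) \<partial>lborel)) (at \<mu>)"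
    by (simp add: q_def)
  moreover have "(\<lambda>t. \<integral>w. tn_kernel t V w * g w \<partial>lborel) = (\<lambda>t. q t * F (?P *v (t - \<mu>)))"
  proof
    fix t
    have "tn_kernel t V w * g w = q t * (tn_kernel \<mu> V w * g w * exp ((?P *v (t - \<mu>)) \<bullet> (w - \<mu>)))" for w
      unfolding tn_kernel_def gauss_kernel_shift[OF V, of t w \<mu>] q_def by simp
    then show "(\<integral>w. tn_kernel t V w * g w \<partial>lborel) = q t * F (?P *v (t - \<mu>))"
      by (simp only: F_def Bochner_Integration.integral_mult_right_zero)
  qed
  ultimately show ?thesis by simp
qed

lemma tn_law_integral:
  fixes V :: "real^'d^'d" and g :: "real^'d \<Rightarrow> 'b::{banach,second_countable_topology}"
  assumes "pos_def V" and [measurable]: "g \<in> borel_measurable borel"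
  shows "(\<integral>w. g w \<partial>tn_law \<mu> V) = inverse (tn_const \<mu> V) *\<^sub>R (\<integral>w. tn_kernel \<mu> V w *\<^sub>R g w \<partial>lborel)"
proof -
  have d: "tn_density \<mu> V w = inverse (tn_const \<mu> V) * tn_kernel \<mu> V w" for w
    by (simp add: tn_density_def tn_kernel_def)
  show ?thesis
    unfolding tn_law_def d using tn_const_pos[OF assms(1), of \<mu>]
    by (subst integral_density) (auto simp: tn_kernel_nonneg simp flip: scaleR_scaleR)
qed

lemma tn_law_integrable:
  fixes V :: "real^'d^'d" and g :: "real^'d \<Rightarrow> 'b::{banach,second_countable_topology}"
  assumes "pos_def V" and [measurable]: "g \<in> borel_measurable borel"
    and "\<And>w. norm (g w) \<le> K * exp (norm (w - \<mu>))"
  shows "integrable (tn_law \<mu> V) g"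
proof -
  have d: "tn_density \<mu> V w = inverse (tn_const \<mu> V) * tn_kernel \<mu> V w" for w
    by (simp add: tn_density_def tn_kernel_def)
  show ?thesis
    unfolding tn_law_def d using tn_const_pos[OF assms(1), of \<mu>]
      integrable_tn_kernel_subexp[OF assms(1,2), of K 1 \<mu>] assms(3)
    by (subst integrable_density) (auto simp: tn_kernel_nonneg simp flip: scaleR_scaleR)
qed

section \<open>Gradient and Hessian of the normalising constant\<close>

lemma outer_mult_vec: "outer u v *v w = (v \<bullet> w) *\<^sub>R u"
  by (simp add: vec_eq_iff outer_def matrix_vector_mult_def inner_vec_def sum_distrib_left mult_ac)

lemma norm_outer: "norm (outer u v) = norm u * norm v"
proof -
  have "outer u v $ i = u $ i *\<^sub>R v" for i
    by (simp add: outer_def vec_eq_iff)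
  then have "norm (outer u v) = L2_set (\<lambda>i. norm (u $ i) * norm v) UNIV"
    by (simp add: norm_vec_def[of "outer u v"])
  also have "\<dots> = norm u * norm v"
    by (simp add: norm_vec_def[of u] L2_set_left_distrib)
  finally show ?thesis .
qed

lemma outer_borel [measurable]:
  "(\<lambda>w. outer (w - a) (w - b)) \<in> borel_measurable (borel :: (real^'d) measure)"
  unfolding outer_def
  by (intro borel_measurable_continuous_onI continuous_intros)

lemma norm_outer_subexp: "norm (outer (w - \<mu>) (w - \<mu>)) \<le> 2 * exp (norm (w - \<mu>))"
  using square_le_exp[of "norm (w - \<mu>)"] by (simp add: norm_outer power2_eq_square)

lemma norm_le_exp: "norm v \<le> 1 * exp (norm v)"
  using exp_ge_add_one_self[of "norm v"] by linarith

lemma gradient_tn_const: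
  fixes V :: "real^'d^'d"
  assumes V: "pos_def V"
  shows "gradient (\<lambda>t. tn_const t V) t = matrix_inv V *v (\<integral>w. tn_kernel t V w *\<^sub>R (w - t) \<partial>lborel)"
proof -
  let ?P = "matrix_inv V" and ?m = "\<integral>w. tn_kernel t V w *\<^sub>R (w - t) \<partial>lborel"
  have P: "transpose ?P = ?P"
    using pos_def_inverse[OF V] by (simp add: pos_def_def)
  have int: "integrable lborel (\<lambda>w. tn_kernel t V w *\<^sub>R (w - t))"
    by (rule integrable_tn_kernel_subexp[OF V, of _ 1 1 t]) (use norm_le_exp in auto)
  have "((\<lambda>t. tn_const t V) has_derivative
      (\<lambda>h. \<integral>w. tn_kernel t V w * ((?P *v h) \<bullet> (w - t)) \<partial>lborel)) (at t)"
    using tn_kernel_integral_has_derivative[OF V, of "\<lambda>_. 1" 1 t] by (simp add: tn_const_eq)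
  moreover have "(\<integral>w. tn_kernel t V w * ((?P *v h) \<bullet> (w - t)) \<partial>lborel) = h \<bullet> (?P *v ?m)" for h
  proof -
    have "(\<integral>w. tn_kernel t V w * ((?P *v h) \<bullet> (w - t)) \<partial>lborel)
        = (\<integral>w. (?P *v h) \<bullet> (tn_kernel t V w *\<^sub>R (w - t)) \<partial>lborel)"
      by simp
    also have "\<dots> = (?P *v h) \<bullet> ?m"
      using int by (rule integral_inner_right)
    also have "\<dots> = h \<bullet> (?P *v ?m)"
      by (rule symmetric_matrix_inner_commute[OF P, symmetric])
    finally show ?thesis .
  qed
  ultimately have "((\<lambda>t. tn_const t V) has_derivative (\<lambda>h. h \<bullet> (?P *v ?m))) (at t)"
    by simp
  from frechet_derivative_at[OF this, symmetric] show ?thesis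
    by (simp add: gradient_def vec_eq_iff inner_axis' )
qed

text \<open>
  Written with integrals about the fixed point \<open>\<mu>\<close>, the gradient at \<open>t\<close> is
  \<open>P (J t - C t (t - \<mu>))\<close>, where \<open>J t\<close> integrates \<open>w - \<mu>\<close> against the kernel centred at \<open>t\<close>.
  At \<open>t = \<mu>\<close> the second factor of the product \<open>C t (t - \<mu>)\<close> vanishes, so the product contributes
  \<open>C \<mu>\<close> times the identity, and the derivative of \<open>C\<close> drops out.
\<close>

lemma hessian_tn_const:
  fixes V :: "real^'d^'d"
  assumes V: "pos_def V"
  shows "hessian (\<lambda>t. tn_const t V) \<mu> =
    matrix_inv V ** (\<integral>w. tn_kernel \<mu> V w *\<^sub>R outer (w - \<mu>) (w - \<mu>) \<partial>lborel) ** matrix_inv V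
    - tn_const \<mu> V *\<^sub>R matrix_inv V"
proof -
  let ?P = "matrix_inv V" and ?A = "\<integral>w. tn_kernel \<mu> V w *\<^sub>R outer (w - \<mu>) (w - \<mu>) \<partial>lborel"
  define J where "J t = (\<integral>w. tn_kernel t V w *\<^sub>R (w - \<mu>) \<partial>lborel)" for t
  have intJ: "integrable lborel (\<lambda>w. tn_kernel t V w *\<^sub>R (w - \<mu>))" for t
  proof (rule integrable_tn_kernel_subexp[OF V, of _ "exp (norm (t - \<mu>))" 1 t])
    fix w
    have "norm (w - \<mu>) \<le> exp (norm (w - \<mu>))"
      using norm_le_exp by simp
    also have "\<dots> \<le> exp (norm (t - \<mu>) + norm (w - t))"
      using norm_triangle_ineq[of "t - \<mu>" "w - t"] by simp
    finally show "norm (w - \<mu>) \<le> exp (norm (t - \<mu>)) * exp (1 * norm (w - t))"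
      by (simp add: exp_add)
  qed measurable
  have intA: "integrable lborel (\<lambda>w. tn_kernel \<mu> V w *\<^sub>R outer (w - \<mu>) (w - \<mu>))"
    by (rule integrable_tn_kernel_subexp[OF V, of _ 2 1 \<mu>]) (use norm_outer_subexp in auto)
  have J: "(J has_derivative (\<lambda>h. ?A *v (?P *v h))) (at \<mu>)"
  proof (subst has_derivative_componentwise_within, intro ballI)
    fix i :: "real^'d"
    assume "i \<in> Basis"
    have "((\<lambda>t. \<integral>w. tn_kernel t V w * (i \<bullet> (w - \<mu>)) \<partial>lborel) has_derivative
        (\<lambda>h. \<integral>w. tn_kernel \<mu> V w * (i \<bullet> (w - \<mu>)) * ((?P *v h) \<bullet> (w - \<mu>)) \<partial>lborel)) (at \<mu>)"
    proof (rule tn_kernel_integral_has_derivative[OF V, of _ 1])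
      fix w
      have "\<bar>i \<bullet> (w - \<mu>)\<bar> \<le> norm i * norm (w - \<mu>)"
        by (rule Cauchy_Schwarz_ineq2)
      then show "\<bar>i \<bullet> (w - \<mu>)\<bar> \<le> 1 * exp (norm (w - \<mu>))"
        using norm_le_exp[of "w - \<mu>"] norm_Basis[OF \<open>i \<in> Basis\<close>] by simp
    qed measurable
    moreover have "(\<integral>w. tn_kernel t V w * (i \<bullet> (w - \<mu>)) \<partial>lborel) = J t \<bullet> i" for t
      unfolding J_def using integral_inner_left[OF intJ[of t], of i] by (simp add: inner_commute)
    moreover have "(\<integral>w. tn_kernel \<mu> V w * (i \<bullet> (w - \<mu>)) * (u \<bullet> (w - \<mu>)) \<partial>lborel) = (?A *v u) \<bullet> i" for u
    proof -
      have lin: "bounded_linear (\<lambda>B :: real^'d^'d. (B *v u) \<bullet> i)"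
        by (intro linear_conv_bounded_linear[THEN iffD1] linearI)
           (simp_all add: matrix_vector_mult_add_rdistrib inner_add_left scaleR_matrix_vector_assoc[symmetric])
      from integral_bounded_linear[OF lin intA]
      show ?thesis
        by (simp add: scaleR_matrix_vector_assoc[symmetric] outer_mult_vec inner_commute mult_ac)
    qed
    ultimately show "((\<lambda>t. J t \<bullet> i) has_derivative (\<lambda>h. (?A *v (?P *v h)) \<bullet> i)) (at \<mu>)"
      by simp
  qed
  have C: "((\<lambda>t. tn_const t V) has_derivative
      (\<lambda>h. \<integral>w. tn_kernel \<mu> V w * ((?P *v h) \<bullet> (w - \<mu>)) \<partial>lborel)) (at \<mu>)"
    using tn_kernel_integral_has_derivative[OF V, of "\<lambda>_. 1" 1 \<mu>] by (simp add: tn_const_eq)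
  have "gradient (\<lambda>t. tn_const t V) = (\<lambda>t. ?P *v (J t - tn_const t V *\<^sub>R (t - \<mu>)))"
  proof
    fix t
    have "(\<integral>w. tn_kernel t V w *\<^sub>R (w - t) \<partial>lborel)
        = (\<integral>w. tn_kernel t V w *\<^sub>R (w - \<mu>) - tn_kernel t V w *\<^sub>R (t - \<mu>) \<partial>lborel)"
      by (rule Bochner_Integration.integral_cong) (auto simp: algebra_simps)
    also have "\<dots> = J t - tn_const t V *\<^sub>R (t - \<mu>)"
      unfolding J_def tn_const_eq
      by (subst Bochner_Integration.integral_diff)
         (auto intro!: intJ integrable_tn_kernel V integral_scaleR_left)
    finally show "gradient (\<lambda>t. tn_const t V) t = ?P *v (J t - tn_const t V *\<^sub>R (t - \<mu>))"
      by (simp add: gradient_tn_const[OF V])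
  qed
  moreover have "((\<lambda>t. ?P *v (J t - tn_const t V *\<^sub>R (t - \<mu>))) has_derivative
      (\<lambda>h. ?P *v (?A *v (?P *v h) - tn_const \<mu> V *\<^sub>R h))) (at \<mu>)"
    by (rule bounded_linear.has_derivative[OF matrix_vector_mul_bounded_linear])
       (auto intro!: derivative_eq_intros J C)
  ultimately have "hessian (\<lambda>t. tn_const t V) \<mu>
      = matrix (\<lambda>h. ?P *v (?A *v (?P *v h) - tn_const \<mu> V *\<^sub>R h))"
    unfolding hessian_def jacobian_def by (simp add: frechet_derivative_at[symmetric])
  also have "(\<lambda>h. ?P *v (?A *v (?P *v h) - tn_const \<mu> V *\<^sub>R h))
      = (\<lambda>h. (?P ** ?A ** ?P - tn_const \<mu> V *\<^sub>R ?P) *v h)"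
    by (simp add: fun_eq_iff matrix_vector_mult_diff_distrib matrix_vector_mult_diff_rdistrib
        matrix_vector_mul_assoc matrix_vector_mult_scaleR scaleR_matrix_vector_assoc matrix_mul_assoc)
  finally show ?thesis by simp
qed

section \<open>The likelihood equations\<close>

text \<open>
  The tilted kernel has inverse covariance \<open>P - 2 s H\<close> and linear parameter \<open>P \<mu> + s h\<close>.  The bound on
  \<open>s\<close> makes the perturbation of the quadratic form smaller than its coercivity constant; completing
  the square then gives the new centre and the constant \<open>b\<close>.
\<close>

lemma gauss_kernel_tilt:
  fixes V H :: "real^'d^'d" and h :: "real^'d"
  assumes V: "pos_def V" and H: "transpose H = H"
  obtains d where "0 < d"
    "\<And>s. \<bar>s\<bar> < d \<Longrightarrow> \<exists>\<mu>' V' b. pos_def V' \<and>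
      (\<forall>w. gauss_kernel \<mu>' V' w = exp b * (gauss_kernel \<mu> V w * exp (s * (c + h \<bullet> w + w \<bullet> (H *v w)))))"
proof -
  define P where "P = matrix_inv V"
  have P: "pos_def P" "transpose P = P"
    using pos_def_inverse[OF V] by (simp_all add: P_def pos_def_def)
  obtain a where a: "0 < a" "\<And>v. a * (norm v)\<^sup>2 \<le> v \<bullet> (P *v v)"
    using pos_def_coercive[OF P(1)] by blast
  obtain K where K: "0 < K" "\<And>v. \<bar>v \<bullet> (H *v v)\<bar> \<le> K * (norm v)\<^sup>2"
    using quadratic_form_bound[of H] by blast
  show thesis
  proof (rule that[of "a / (2 * K)"])
    fix s :: real
    assume s: "\<bar>s\<bar> < a / (2 * K)"
    define Q where "Q = P - (2 * s) *\<^sub>R H"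
    have Qv: "Q *v v = P *v v - (2 * s) *\<^sub>R (H *v v)" for v
      by (simp add: Q_def matrix_vector_mult_diff_rdistrib scaleR_matrix_vector_assoc)
    have Qs: "transpose Q = Q"
      using P(2) H by (simp add: Q_def transpose_def vec_eq_iff)
    have Q: "pos_def Q"
      unfolding pos_def_def
    proof (intro conjI allI impI Qs)
      fix v :: "real^'d"
      assume v: "v \<noteq> 0"
      have "\<bar>2 * s * (v \<bullet> (H *v v))\<bar> \<le> 2 * \<bar>s\<bar> * (K * (norm v)\<^sup>2)"
        unfolding abs_mult using K(2)[of v] by (intro mult_mono) auto
      also have "\<dots> = (2 * \<bar>s\<bar> * K) * (norm v)\<^sup>2" by simp
      also have "\<dots> < a * (norm v)\<^sup>2"
        using s K(1) v by (intro mult_strict_right_mono) (auto simp: field_simps)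
      also have "\<dots> \<le> v \<bullet> (P *v v)" by (rule a)
      finally show "0 < v \<bullet> (Q *v v)"
        by (simp add: Qv inner_diff_right)
    qed
    define V' where "V' = matrix_inv Q"
    define \<theta> where "\<theta> = P *v \<mu> + s *\<^sub>R h"
    define m where "m = V' *v \<theta>"
    have V': "pos_def V'" "matrix_inv V' = Q"
      unfolding V'_def by (rule pos_def_inverse[OF Q], rule matrix_inv_matrix_inv[OF Q])
    have Qm: "Q *v m = \<theta>"
      by (simp add: m_def V'_def matrix_vector_mul_assoc pos_def_matrix_inv(1)[OF Q])
    define b where "b = (\<mu> \<bullet> (P *v \<mu>) - m \<bullet> \<theta>) / 2 - s * c"
    have "gauss_kernel m V' w = exp b * (gauss_kernel \<mu> V w * exp (s * (c + h \<bullet> w + w \<bullet> (H *v w))))" for w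
    proof -
      have 1: "m \<bullet> (Q *v w) = w \<bullet> \<theta>"
        by (metis Qm Qs inner_commute symmetric_matrix_inner_commute)
      have 2: "\<mu> \<bullet> (P *v w) = w \<bullet> (P *v \<mu>)"
        by (metis P(2) inner_commute symmetric_matrix_inner_commute)
      have "(w - m) \<bullet> (Q *v (w - m)) = w \<bullet> (Q *v w) - 2 * (w \<bullet> \<theta>) + m \<bullet> \<theta>"
        by (simp add: matrix_vector_mult_diff_distrib inner_diff_left inner_diff_right Qm 1)
      moreover have "w \<bullet> (Q *v w) = w \<bullet> (P *v w) - 2 * s * (w \<bullet> (H *v w))"
        by (simp add: Qv inner_diff_right)
      moreover have "w \<bullet> \<theta> = w \<bullet> (P *v \<mu>) + s * (h \<bullet> w)"
        by (simp add: \<theta>_def inner_add_right inner_commute)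
      moreover have "(w - \<mu>) \<bullet> (P *v (w - \<mu>)) = w \<bullet> (P *v w) - 2 * (w \<bullet> (P *v \<mu>)) + \<mu> \<bullet> (P *v \<mu>)"
        by (simp add: matrix_vector_mult_diff_distrib inner_diff_left inner_diff_right 2)
      ultimately show ?thesis
        unfolding gauss_kernel_def V'(2) P_def[symmetric]
        by (simp add: mult_exp_exp b_def algebra_simps add_divide_distrib diff_divide_distrib)
    qed
    then show "\<exists>\<mu>' V' b. pos_def V' \<and>
      (\<forall>w. gauss_kernel \<mu>' V' w = exp b * (gauss_kernel \<mu> V w * exp (s * (c + h \<bullet> w + w \<bullet> (H *v w)))))"
      using V'(1) by blast
  qed (use a K in simp)
qed

text \<open>
  The score equations of the exponential family, obtained by comparing the maximum with nearby
  tilted laws.  Symmetry of \<open>H\<close> loses no statistics, since a quadratic form depends on the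
  symmetric part of its matrix alone.
\<close>

lemma mle_matches_quadratic:
  fixes V H :: "real^'d^'d" and h :: "real^'d" and x :: "nat \<Rightarrow> real^'d"
  assumes n: "n \<ge> 1" and x: "\<And>j. j \<in> {1..n} \<Longrightarrow> x j \<in> nonneg_orthant"
    and mle: "is_mle n x \<mu> V" and H: "transpose H = H"
  shows "(\<integral>w. c + h \<bullet> w + w \<bullet> (H *v w) \<partial>tn_law \<mu> V) =
    (\<Sum>j=1..n. c + h \<bullet> x j + x j \<bullet> (H *v x j)) / n"
proof -
  have V: "pos_def V"
    using mle by (auto simp: is_mle_def is_arg_max_def)
  have opt: "log_likelihood n x \<mu>' V' \<le> log_likelihood n x \<mu> V" if "pos_def V'" for \<mu>' V'
    using mle that by (auto simp: is_mle_def is_arg_max_def not_less)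
  define T where "T w = c + h \<bullet> w + w \<bullet> (H *v w)" for w
  define m where "m = (\<Sum>j=1..n. T (x j)) / n"
  have [measurable]: "T \<in> borel_measurable borel"
    unfolding T_def
    by (intro borel_measurable_continuous_onI continuous_intros linear_continuous_on_compose[OF _ matrix_vector_mul_linear])
  obtain K where K: "0 < K" "\<And>v. \<bar>v \<bullet> (H *v v)\<bar> \<le> K * (norm v)\<^sup>2"
    using quadratic_form_bound[of H] by blast

  \<comment> \<open>The statistic grows at most quadratically in the distance from \<open>\<mu>\<close>, so small exponential
    moments exist.\<close>
  define A where "A = \<bar>c - m\<bar> + norm h * (1 + norm \<mu>) + 2 * K * (norm \<mu>)\<^sup>2"
  define B where "B = norm h + 2 * K"
  have B: "0 < B" using K by (simp add: B_def add_nonneg_pos)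
  have T_bound: "\<bar>T w - m\<bar> \<le> A + B * (norm (w - \<mu>))\<^sup>2" for w
  proof -
    define r where "r = norm (w - \<mu>)"
    have r0: "0 \<le> r"
      by (simp add: r_def)
    have r: "r \<le> 1 + r\<^sup>2"
      using zero_le_power2[of "r - 1"] r0 by (simp add: power2_diff)
    have w: "norm w \<le> norm \<mu> + r"
      using norm_triangle_ineq[of \<mu> "w - \<mu>"] by (simp add: r_def)
    have "(norm w)\<^sup>2 \<le> (norm \<mu> + r)\<^sup>2"
      using w by (intro power_mono) auto
    also have "\<dots> \<le> 2 * (norm \<mu>)\<^sup>2 + 2 * r\<^sup>2"
      using zero_le_power2[of "norm \<mu> - r"] by (simp add: power2_eq_square algebra_simps)
    finally have w2: "(norm w)\<^sup>2 \<le> 2 * (norm \<mu>)\<^sup>2 + 2 * r\<^sup>2" .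
    have "\<bar>h \<bullet> w\<bar> \<le> norm h * norm w"
      by (rule Cauchy_Schwarz_ineq2)
    also have "\<dots> \<le> norm h * (norm \<mu> + (1 + r\<^sup>2))"
      using w r by (intro mult_left_mono) auto
    finally have 1: "\<bar>h \<bullet> w\<bar> \<le> norm h * (norm \<mu> + (1 + r\<^sup>2))" .
    have "\<bar>w \<bullet> (H *v w)\<bar> \<le> K * (2 * (norm \<mu>)\<^sup>2 + 2 * r\<^sup>2)"
      by (rule order_trans[OF K(2) mult_left_mono[OF w2]]) (use K in simp)
    with 1 have "\<bar>T w - m\<bar> \<le> \<bar>c - m\<bar> + norm h * (norm \<mu> + (1 + r\<^sup>2)) + K * (2 * (norm \<mu>)\<^sup>2 + 2 * r\<^sup>2)"
      unfolding T_def by linarith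
    also have "\<dots> = A + B * r\<^sup>2"
      by (simp add: A_def B_def algebra_simps)
    finally show ?thesis by (simp add: r_def)
  qed

  obtain e where e: "0 < e"
    "\<And>(g :: real^'d \<Rightarrow> real) K.
      \<lbrakk>g \<in> borel_measurable borel; \<And>w. norm (g w) \<le> K * exp (e * (norm (w - \<mu>))\<^sup>2)\<rbrakk>
      \<Longrightarrow> integrable lborel (\<lambda>w. tn_kernel \<mu> V w *\<^sub>R g w)"
    using integrable_tn_kernel_subgaussian[OF V] by blast
  define \<epsilon> where "\<epsilon> = e / B"
  have \<epsilon>: "0 < \<epsilon>" using e B by (simp add: \<epsilon>_def)
  have T_exp: "\<epsilon> * \<bar>T w - m\<bar> \<le> \<epsilon> * A + e * (norm (w - \<mu>))\<^sup>2" for w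
    using mult_left_mono[OF T_bound, of \<epsilon> w] \<epsilon> B by (simp add: \<epsilon>_def field_simps)
  have intT: "integrable lborel (\<lambda>w. tn_kernel \<mu> V w *\<^sub>R exp (\<epsilon> * norm (T w - m)))"
  proof (rule e(2))
    show "norm (exp (\<epsilon> * norm (T w - m))) \<le> exp (\<epsilon> * A) * exp (e * (norm (w - \<mu>))\<^sup>2)" for w
      using T_exp[of w] by (simp add: mult_exp_exp)
  qed measurable
  define \<phi> where "\<phi> s = (\<integral>w. tn_kernel \<mu> V w * exp (s * (T w - m)) \<partial>lborel)" for s :: real
  have der: "(\<phi> has_derivative (\<lambda>s. \<integral>w. tn_kernel \<mu> V w * (s * (T w - m)) \<partial>lborel)) (at 0)"
    using has_derivative_exp_integral[of "\<lambda>w. T w - m" lborel "tn_kernel \<mu> V" \<epsilon>] \<epsilon> intT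
    unfolding \<phi>_def by simp
  have DER: "(\<phi> has_real_derivative (\<integral>w. tn_kernel \<mu> V w * (T w - m) \<partial>lborel)) (at 0)"
    unfolding has_field_derivative_def
    by (rule has_derivative_eq_rhs[OF der])
       (simp add: fun_eq_iff mult.left_commute[of _ _ "_ - _"] mult.commute flip: Bochner_Integration.integral_mult_right_zero)

  \<comment> \<open>Optimality, applied to the tilted law, makes \<open>0\<close> a local minimum of \<open>\<phi>\<close>: the constant \<open>b\<close> of the
    tilt cancels between kernel and normalising constant.\<close>
  obtain d where d: "0 < d"
    "\<And>s. \<bar>s\<bar> < d \<Longrightarrow> \<exists>\<mu>' V' b. pos_def V' \<and>
      (\<forall>w. gauss_kernel \<mu>' V' w = exp b * (gauss_kernel \<mu> V w * exp (s * (c + h \<bullet> w + w \<bullet> (H *v w)))))"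
    using gauss_kernel_tilt[OF V H] by blast
  have min: "\<phi> 0 \<le> \<phi> s" if s: "\<bar>s\<bar> < d" for s
  proof -
    obtain \<mu>' V' b where V': "pos_def V'"
      and gk: "\<And>w. gauss_kernel \<mu>' V' w = exp b * (gauss_kernel \<mu> V w * exp (s * T w))"
      using d(2)[OF s] unfolding T_def by blast
    have k: "tn_kernel \<mu>' V' w = exp (b + s * m) * (tn_kernel \<mu> V w * exp (s * (T w - m)))" for w
      by (simp add: tn_kernel_def gk exp_add exp_diff right_diff_distrib)
    have C': "tn_const \<mu>' V' = exp (b + s * m) * \<phi> s"
      unfolding tn_const_eq k \<phi>_def by (rule Bochner_Integration.integral_mult_right_zero)
    have C: "tn_const \<mu> V = \<phi> 0"
      by (simp add: tn_const_eq \<phi>_def)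
    have pos: "0 < \<phi> s" "0 < \<phi> 0"
      using tn_const_pos[OF V', of \<mu>'] tn_const_pos[OF V, of \<mu>] by (simp_all add: C C' zero_less_mult_iff)
    have "ln (tn_density \<mu>' V' (x j)) = ln (tn_density \<mu> V (x j)) + s * (T (x j) - m) - ln (\<phi> s) + ln (\<phi> 0)"
      if j: "j \<in> {1..n}" for j
    proof -
      have g: "0 < gauss_kernel \<mu> V (x j)"
        by (simp add: gauss_kernel_def)
      show ?thesis
        using x[OF j] pos g
        by (simp add: tn_density_def gk C C' ln_mult ln_inverse algebra_simps)
    qed
    then have "log_likelihood n x \<mu>' V'
        = (\<Sum>j=1..n. ln (tn_density \<mu> V (x j)) + s * (T (x j) - m) - ln (\<phi> s) + ln (\<phi> 0))"
      by (simp add: log_likelihood_def)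
    also have "\<dots> = log_likelihood n x \<mu> V + s * (\<Sum>j=1..n. T (x j) - m) + n * (ln (\<phi> 0) - ln (\<phi> s))"
      by (simp add: log_likelihood_def sum.distrib sum_subtractf sum_distrib_left algebra_simps)
    also have "(\<Sum>j=1..n. T (x j) - m) = 0"
      using n by (simp add: sum_subtractf m_def)
    finally have "n * (ln (\<phi> 0) - ln (\<phi> s)) \<le> 0"
      using opt[OF V', of \<mu>'] by simp
    then have "ln (\<phi> 0) \<le> ln (\<phi> s)"
      using n by (simp add: mult_le_0_iff)
    then show ?thesis
      using pos by simp
  qed
  have zero: "(\<integral>w. tn_kernel \<mu> V w * (T w - m) \<partial>lborel) = 0"
    by (rule DERIV_local_min[OF DER d(1)]) (use min in simp)

  have "(\<integral>w. tn_kernel \<mu> V w * (T w - m) \<partial>lborel)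
      = (\<integral>w. tn_kernel \<mu> V w * T w \<partial>lborel) - tn_const \<mu> V * m"
  proof -
    have "integrable lborel (\<lambda>w. tn_kernel \<mu> V w *\<^sub>R (T w - m))"
    proof (rule e(2))
      show "norm (T w - m) \<le> (exp (\<epsilon> * A) / \<epsilon>) * exp (e * (norm (w - \<mu>))\<^sup>2)" for w
      proof -
        have "\<epsilon> * \<bar>T w - m\<bar> \<le> exp (\<epsilon> * A + e * (norm (w - \<mu>))\<^sup>2)"
          using T_exp[of w] exp_ge_add_one_self[of "\<epsilon> * A + e * (norm (w - \<mu>))\<^sup>2"] by linarith
        then show ?thesis
          using \<epsilon> by (simp add: exp_add field_simps)
      qed
    qed measurable
    then have 1: "integrable lborel (\<lambda>w. tn_kernel \<mu> V w * (T w - m) + tn_kernel \<mu> V w * m)"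
      by (intro Bochner_Integration.integrable_add) (simp_all add: integrable_tn_kernel[OF V])
    then have "integrable lborel (\<lambda>w. tn_kernel \<mu> V w * T w)"
      by (simp add: algebra_simps)
    then show ?thesis
      by (simp add: right_diff_distrib tn_const_eq integrable_tn_kernel[OF V])
  qed
  then have "(\<integral>w. tn_kernel \<mu> V w * T w \<partial>lborel) = tn_const \<mu> V * m"
    using zero by simp
  then have "(\<integral>w. T w \<partial>tn_law \<mu> V) = m"
    using tn_const_pos[OF V, of \<mu>] by (simp add: tn_law_integral[OF V])
  then show ?thesis
    by (simp add: T_def m_def)
qed

lemma scatter_nth:
  "scatter n x a $ j $ k = (\<Sum>i=1..n. (x i - a) $ j * (x i - a) $ k) / n"
  by (simp add: scatter_def outer_def)

text \<open>
  The parallel axis theorem: the cross terms vanish because deviations from the sample mean sum to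
  zero.
\<close>

lemma scatter_shift:
  assumes "n \<ge> 1"
  shows "scatter n x a = scatter n x (sample_mean n x) + outer (sample_mean n x - a) (sample_mean n x - a)"
proof -
  let ?m = "sample_mean n x"
  have m: "(\<Sum>i=1..n. x i $ j) = n * ?m $ j" for j
    using assms by (simp add: sample_mean_def)
  have "(\<Sum>i=1..n. (x i - a) $ j * (x i - a) $ k)
      = (\<Sum>i=1..n. (x i - ?m) $ j * (x i - ?m) $ k) + n * ((?m - a) $ j * (?m - a) $ k)" for j k
  proof -
    have "(\<Sum>i=1..n. (x i - a) $ j * (x i - a) $ k - (x i - ?m) $ j * (x i - ?m) $ k)
      = (\<Sum>i=1..n. (?m - a) $ k * x i $ j + (?m - a) $ j * x i $ k + (a $ j * a $ k - ?m $ j * ?m $ k))"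
      by (rule sum.cong) (auto simp: algebra_simps)
    also have "\<dots> = n * ((?m - a) $ k * ?m $ j + (?m - a) $ j * ?m $ k + (a $ j * a $ k - ?m $ j * ?m $ k))"
      by (simp only: sum.distrib sum_distrib_left[symmetric] m sum_constant)
         (simp add: algebra_simps)
    also have "\<dots> = n * ((?m - a) $ j * (?m - a) $ k)"
      by (simp add: algebra_simps)
    finally show ?thesis by (simp add: sum_subtractf)
  qed
  then show ?thesis
    using assms by (simp add: vec_eq_iff scatter_nth outer_def add_divide_distrib)
qed

text \<open>
  The entry \<open>(w - a) $ j * (w - a) $ k\<close> is a quadratic polynomial whose symmetric matrix is the
  symmetrised elementary matrix; the integrability facts allow mean and covariance to be read off
  entrywise, as the vector-valued integrals require.
\<close>

lemma mle_matches_moments: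
  fixes V :: "real^'d^'d" and x :: "nat \<Rightarrow> real^'d"
  assumes n: "n \<ge> 1" and x: "\<And>j. j \<in> {1..n} \<Longrightarrow> x j \<in> nonneg_orthant"
    and mle: "is_mle n x \<mu> V"
  shows "tn_mean \<mu> V = sample_mean n x"
    and "(\<integral>w. outer (w - a) (w - a) \<partial>tn_law \<mu> V) = scatter n x a"
proof -
  have V: "pos_def V"
    using mle by (auto simp: is_mle_def is_arg_max_def)
  have ae: "norm (w - a) \<le> exp (norm (\<mu> - a)) * exp (norm (w - \<mu>))" for w a
  proof -
    have "norm (w - a) \<le> exp (norm (w - a))"
      using norm_le_exp by simp
    also have "\<dots> \<le> exp (norm (\<mu> - a) + norm (w - \<mu>))"
      using norm_triangle_ineq[of "\<mu> - a" "w - \<mu>"] by simp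
    finally show ?thesis by (simp add: exp_add)
  qed
  have int1: "integrable (tn_law \<mu> V) (\<lambda>w. w)"
    by (rule tn_law_integrable[OF V, of _ "exp (norm \<mu>)"]) (use ae[of _ 0] in auto)
  show "tn_mean \<mu> V = sample_mean n x"
  proof (subst vec_eq_iff, intro allI)
    fix i
    have "tn_mean \<mu> V $ i = (\<integral>w. w $ i \<partial>tn_law \<mu> V)"
      unfolding tn_mean_def using integral_bounded_linear[OF bounded_linear_vec_nth int1] by simp
    also have "\<dots> = (\<integral>w. 0 + axis i 1 \<bullet> w + w \<bullet> (0 *v w) \<partial>tn_law \<mu> V)"
      by (simp add: inner_axis')
    also have "\<dots> = (\<Sum>j=1..n. 0 + axis i 1 \<bullet> x j + x j \<bullet> (0 *v x j)) / n"
      by (rule mle_matches_quadratic[OF n x mle]) (simp_all add: transpose_def vec_eq_iff)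
    also have "\<dots> = sample_mean n x $ i"
      by (simp add: sample_mean_def inner_axis')
    finally show "tn_mean \<mu> V $ i = sample_mean n x $ i" .
  qed
  have "norm (outer (w - a) (w - a)) \<le> (2 * exp (norm (\<mu> - a))) * exp (norm (w - \<mu>))" for w
  proof -
    have "norm (outer (w - a) (w - a)) \<le> 2 * exp (norm (w - a))"
      by (rule norm_outer_subexp)
    also have "\<dots> \<le> 2 * exp (norm (\<mu> - a) + norm (w - \<mu>))"
      using norm_triangle_ineq[of "\<mu> - a" "w - \<mu>"] by simp
    finally show ?thesis by (simp add: exp_add)
  qed
  then have int2: "integrable (tn_law \<mu> V) (\<lambda>w. outer (w - a) (w - a))"
    by (intro tn_law_integrable[OF V, of _ "2 * exp (norm (\<mu> - a))"]) auto
  show "(\<integral>w. outer (w - a) (w - a) \<partial>tn_law \<mu> V) = scatter n x a"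
  proof (subst vec_eq_iff, intro allI, subst vec_eq_iff, intro allI)
    fix j k
    define H :: "real^'d^'d" where
      "H = (1/2) *\<^sub>R (outer (axis j 1) (axis k 1) + outer (axis k 1) (axis j 1))"
    define h :: "real^'d" where "h = - (a $ k *\<^sub>R axis j 1 + a $ j *\<^sub>R axis k 1)"
    have H: "transpose H = H"
      by (simp add: H_def outer_def transpose_def vec_eq_iff mult.commute)
    have q: "(w - a) $ j * (w - a) $ k = a $ j * a $ k + h \<bullet> w + w \<bullet> (H *v w)" for w
      by (simp add: H_def h_def outer_mult_vec matrix_vector_mult_add_rdistrib inner_axis inner_axis'
          inner_add_left inner_add_right algebra_simps flip: scaleR_matrix_vector_assoc)
    have bl: "bounded_linear (\<lambda>B :: real^'d^'d. B $ j $ k)"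
      using bounded_linear_compose[OF bounded_linear_vec_nth[of k] bounded_linear_vec_nth[of j]] by simp
    have "(\<integral>w. outer (w - a) (w - a) \<partial>tn_law \<mu> V) $ j $ k
        = (\<integral>w. (w - a) $ j * (w - a) $ k \<partial>tn_law \<mu> V)"
      using integral_bounded_linear[OF bl int2] by (simp add: outer_def)
    also have "\<dots> = (\<Sum>i=1..n. (x i - a) $ j * (x i - a) $ k) / n"
      unfolding q by (rule mle_matches_quadratic[OF n x mle H])
    also have "\<dots> = scatter n x a $ j $ k"
      by (simp only: scatter_nth)
    finally show "(\<integral>w. outer (w - a) (w - a) \<partial>tn_law \<mu> V) $ j $ k = scatter n x a $ j $ k" .
  qed
qed

theorem theorem4p4:
  fixes M :: "'a measure" and X :: "nat \<Rightarrow> 'a \<Rightarrow> real^'d" and n :: nat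
    and \<mu> muhat :: "real^'d" and V Vhat :: "real^'d^'d"
    and \<omega> :: 'a and x :: "nat \<Rightarrow> real^'d"
  assumes "prob_space M"
    and "n \<ge> 1"
    and "pos_def V"
    and "prob_space.indep_vars M (\<lambda>_. borel) X {1..n}"
    and "\<And>j. j \<in> {1..n} \<Longrightarrow> distributed M lborel (X j) (\<lambda>y. ennreal (tn_density \<mu> V y))"
    and "\<omega> \<in> space M"
    and "\<And>j. j \<in> {1..n} \<Longrightarrow> x j = X j \<omega>"
    and "\<And>j. j \<in> {1..n} \<Longrightarrow> x j \<in> nonneg_orthant"
    and "is_mle n x muhat Vhat"
  shows "muhat + inverse (tn_const muhat Vhat) *\<^sub>R
           (Vhat *v gradient (\<lambda>t. tn_const t Vhat) muhat) = sample_mean n x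
       \<and> Vhat + inverse (tn_const muhat Vhat) *\<^sub>R
           (Vhat ** hessian (\<lambda>t. tn_const t Vhat) muhat ** Vhat)
         - outer (sample_mean n x - muhat) (sample_mean n x - muhat)
         = scatter n x (sample_mean n x)
       \<and> tn_mean muhat Vhat = sample_mean n x
       \<and> tn_cov muhat Vhat = scatter n x (sample_mean n x)"
proof -
  have Vhat: "pos_def Vhat"
    using assms(9) by (auto simp: is_mle_def is_arg_max_def)
  note inv = pos_def_matrix_inv[OF Vhat]
  have moments: "tn_mean muhat Vhat = sample_mean n x"
    "(\<integral>w. outer (w - a) (w - a) \<partial>tn_law muhat Vhat) = scatter n x a" for a
    using mle_matches_moments[of n x muhat Vhat] assms(2,8,9) by blast+
  let ?P = "matrix_inv Vhat" and ?C = "tn_const muhat Vhat" and ?m = "sample_mean n x"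
  let ?A = "\<integral>w. tn_kernel muhat Vhat w *\<^sub>R outer (w - muhat) (w - muhat) \<partial>lborel"
  have C: "0 < ?C" by (rule tn_const_pos[OF Vhat])
  have "inverse ?C *\<^sub>R (Vhat *v gradient (\<lambda>t. tn_const t Vhat) muhat)
      = inverse ?C *\<^sub>R (\<integral>w. tn_kernel muhat Vhat w *\<^sub>R (w - muhat) \<partial>lborel)"
    by (simp add: gradient_tn_const[OF Vhat] matrix_vector_mul_assoc inv)
  also have "(\<integral>w. tn_kernel muhat Vhat w *\<^sub>R (w - muhat) \<partial>lborel)
      = (\<integral>w. tn_kernel muhat Vhat w *\<^sub>R w - tn_kernel muhat Vhat w *\<^sub>R muhat \<partial>lborel)"
    by (simp add: algebra_simps)
  also have "\<dots> = (\<integral>w. tn_kernel muhat Vhat w *\<^sub>R w \<partial>lborel) - ?C *\<^sub>R muhat"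
  proof -
    have "integrable lborel (\<lambda>w. tn_kernel muhat Vhat w *\<^sub>R (w - muhat) + tn_kernel muhat Vhat w *\<^sub>R muhat)"
    proof (rule Bochner_Integration.integrable_add)
      show "integrable lborel (\<lambda>w. tn_kernel muhat Vhat w *\<^sub>R (w - muhat))"
        by (rule integrable_tn_kernel_subexp[OF Vhat, of _ 1 1 muhat]) (use norm_le_exp in auto)
    qed (simp add: integrable_tn_kernel[OF Vhat])
    then have "integrable lborel (\<lambda>w. tn_kernel muhat Vhat w *\<^sub>R w)"
      by (simp add: algebra_simps)
    then show ?thesis
      by (subst Bochner_Integration.integral_diff)
         (auto simp: tn_const_eq intro!: integrable_tn_kernel Vhat integral_scaleR_left)
  qed
  also have "inverse ?C *\<^sub>R \<dots> = tn_mean muhat Vhat - muhat"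
    using C by (simp add: tn_mean_def tn_law_integral[OF Vhat] scaleR_diff_right)
  finally have first: "inverse ?C *\<^sub>R (Vhat *v gradient (\<lambda>t. tn_const t Vhat) muhat) = ?m - muhat"
    by (simp only: moments(1))
  have "Vhat ** hessian (\<lambda>t. tn_const t Vhat) muhat ** Vhat = ?A - ?C *\<^sub>R Vhat"
  proof -
    have VP: "Vhat *v (?P *v v) = v" and PV: "?P *v (Vhat *v v) = v" for v
      by (simp_all add: matrix_vector_mul_assoc inv)
    show ?thesis
      unfolding hessian_tn_const[OF Vhat] matrix_eq
      by (simp add: matrix_vector_mul_assoc[symmetric] matrix_vector_mult_diff_distrib
          matrix_vector_mult_diff_rdistrib scaleR_matrix_vector_assoc[symmetric]
          matrix_vector_mult_scaleR VP PV)
  qed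
  then have "Vhat + inverse ?C *\<^sub>R (Vhat ** hessian (\<lambda>t. tn_const t Vhat) muhat ** Vhat)
      = (\<integral>w. outer (w - muhat) (w - muhat) \<partial>tn_law muhat Vhat)"
    using C by (simp add: tn_law_integral[OF Vhat] scaleR_diff_right)
  also have "\<dots> = scatter n x muhat"
    by (rule moments(2))
  also have "\<dots> = scatter n x ?m + outer (?m - muhat) (?m - muhat)"
    by (rule scatter_shift[OF assms(2)])
  finally have second: "Vhat + inverse ?C *\<^sub>R (Vhat ** hessian (\<lambda>t. tn_const t Vhat) muhat ** Vhat)
      = scatter n x ?m + outer (?m - muhat) (?m - muhat)" .
  have "tn_cov muhat Vhat = scatter n x ?m"
    unfolding tn_cov_def moments(1) by (rule moments(2))
  then show ?thesis
    using first second moments(1) by simp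
qed

end
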